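(* Let $T,m,n\ge 1$ be integers, $1\le p<\infty$, $\gamma>0$, $c>0$, let $\mathbf{X}$ be a collection of $m$ trajectories and $\mathbf{Y}$ a collection of $n$ trajectories on the time steps $\{1,\dots,T\}$ in $\mathbb{R}^N$, and let $D^t\in\mathbb{R}_+^{(m+1)\times(n+1)}$, $t=1,\dots,T$, be the associated cost matrices (see context). Let $\bar\mu=(\mathbf{1}_m^\top,n)^\top\in\mathbb{R}^{m+1}$ and $\tilde\mu=(\mathbf{1}_n^\top,m)^\top\in\mathbb{R}^{n+1}$, where $\mathbf{1}_\ell\in\mathbb{R}^\ell$ is the all-ones vector. For $i,k\in\{1,\dots,m+1\}$ and $j,l\in\{1,\dots,n+1\}$ let $$F_{(i,j),(k,l)}=\begin{cases}\dfrac{\gamma^p}{2}\,(1-\delta_{ik}\delta_{jl})\big((1-\delta_{k,m+1})(1-\delta_{l,n+1})+(1-\delta_{i,m+1})(1-\delta_{j,n+1})\big), & \text{if } i=k,\\[1ex] \infty, & \text{otherwise,}\end{cases}$$ where $\delta$ is the Kronecker delta. Then the multimarginal optimal transport problem $$\min_{M\in\mathcal{M}_+}\ \langle C,M\rangle\quad\text{subject to}\quad P_t(M)\mathbf{1}_{n+1}=\bar\mu,\quad P_t(M)^\top\mathbf{1}_{m+1}=\tilde\mu,\qquad t=1,\dots,T,$$ where $$C_{(i_1,j_1),\dots,(i_T,j_T)}=\sum_{t=1}^T D^t_{(i_t,j_t)}+\sum_{t=1}^{T-1}F_{(i_t,j_t),(i_{t+1},j_{t+1})},$$ and the LP-relaxed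 TGOSPA problem (see context) have the same optimal value.
   Context: Trajectories: a trajectory on time steps $\{1,\dots,T\}$ is a sequence $(\boldsymbol{x}^1,\dots,\boldsymbol{x}^T)$ of sets, where each $\boldsymbol{x}^t$ is either $\{x^t\}$ for some $x^t\in\mathbb{R}^N$ (alive in state $x^t$) or $\varnothing$ (not alive). For $i=1,\dots,m$, $\boldsymbol{x}_i^t$ is the (possibly empty) state of the $i$-th trajectory of $\mathbf{X}$ at time $t$, and for $j=1,\dots,n$, $\boldsymbol{y}_j^t$ is that of the $j$-th trajectory of $\mathbf{Y}$. Set $\boldsymbol{x}_{m+1}^t=\varnothing$ and $\boldsymbol{y}_{n+1}^t=\varnothing$ for all $t$. Cost matrices: for $i=1,\dots,m+1$, $j=1,\dots,n+1$, $$(D^t_{(i,j)})^{1/p}=\begin{cases}\min(\|x_i^t-y_j^t\|,c), & \text{if } \boldsymbol{x}_i^t=\{x_i^t\},\ \boldsymbol{y}_j^t=\{y_j^t\},\\ 0, & \text{if } \boldsymbol{x}_i^t=\varnothing,\ \boldsymbol{y}_j^t=\varnothing,\\ c/2^{1/p}, & \text{otherwise,}\end{cases}$$ where $\|\cdot\|$ is the norm on $\mathbb{R}^N$. LP-relaxed TGOSPA problem: minimize $$\sum_{t=1}^T\sum_{i=1}^{m+1}\sum_{j=1}^{n+1}D^t_{(i,j)}W^t_{(i,j)}+\frac{\gamma^p}{2}\sum_{t=1}^{T-1}\sum_{i=1}^m\sum_{j=1}^n\big|W^{t+1}_{(i,j)}-W^t_{(i,j)}\big|$$ over real $(m+1)\times(n+1)$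 matrices $W^1,\dots,W^T$ with nonnegative entries satisfying, for every $t$, $\sum_{i=1}^{m+1}W^t_{(i,j)}=1$ for $j=1,\dots,n$ and $\sum_{j=1}^{n+1}W^t_{(i,j)}=1$ for $i=1,\dots,m$. (The unrelaxed TGOSPA problem has binary entries instead of nonnegative ones.) Tensors: $\mathcal{M}_+$ is the set of nonnegative real tensors $M$ with entries $M_{(i_1,j_1),\dots,(i_T,j_T)}$ indexed by $i_1,\dots,i_T\in\{1,\dots,m+1\}$ and $j_1,\dots,j_T\in\{1,\dots,n+1\}$. $P_t(M)$ is the $(m+1)\times(n+1)$ matrix whose entry $P_t(M)_{(i_t,j_t)}$ is the sum of $M_{(i_1,j_1),\dots,(i_T,j_T)}$ over all index pairs except $(i_t,j_t)$. $\langle C,M\rangle$ is the sum over all indices of the products of entries, with the convention $\infty\cdot 0=0$. *)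

theory Defs
  imports "HOL-Analysis.Analysis"
begin

section \<open>Trajectories and cost matrices\<close>

text \<open>The state of a trajectory at a time step is either a singleton, encoded by \<open>Some x\<close>,
  or empty, encoded by \<open>None\<close>. A collection of \<open>m\<close> trajectories is a family indexed by
  \<open>{1..m}\<close>; only the values at the time steps \<open>{1..T}\<close> are used.\<close>

type_synonym 'a trajectory = "nat \<Rightarrow> 'a option"

definition state :: "nat \<Rightarrow> (nat \<Rightarrow> 'a trajectory) \<Rightarrow> nat \<Rightarrow> nat \<Rightarrow> 'a option" where
  "state m X i t = (if i \<in> {1..m} then X i t else None)"

fun base_cost :: "real \<Rightarrow> real \<Rightarrow> ('a::real_normed_vector) option \<Rightarrow> 'a option \<Rightarrow> real" where
  "base_cost p c (Some x) (Some y) = min (norm (x - y)) c"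
| "base_cost p c None None = 0"
| "base_cost p c _ _ = c / 2 powr (1 / p)"

definition cost_matrix ::
  "real \<Rightarrow> real \<Rightarrow> nat \<Rightarrow> nat \<Rightarrow> (nat \<Rightarrow> ('a::real_normed_vector) trajectory) \<Rightarrow> (nat \<Rightarrow> 'a trajectory)
    \<Rightarrow> nat \<Rightarrow> nat \<times> nat \<Rightarrow> real" where
  "cost_matrix p c m n X Y t = (\<lambda>(i, j). base_cost p c (state m X i t) (state n Y j t) powr p)"

section \<open>Optimal values\<close>

definition is_optimal_value :: "('a \<Rightarrow> ereal) \<Rightarrow> 'a set \<Rightarrow> ereal \<Rightarrow> bool" where
  "is_optimal_value f S v \<longleftrightarrow> (\<exists>x. is_arg_min f (\<lambda>x. x \<in> S) x \<and> f x = v)"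

section \<open>The LP-relaxed TGOSPA problem\<close>

text \<open>In both problems \<open>D t (i, j)\<close> is the cost matrix at time \<open>t\<close>. Matrices and tensors are
  total functions; their values outside the stated index ranges enter neither the constraints
  nor the objective.\<close>

definition lp_feasible :: "nat \<Rightarrow> nat \<Rightarrow> nat \<Rightarrow> (nat \<Rightarrow> nat \<times> nat \<Rightarrow> real) set" where
  "lp_feasible T m n = {W. \<forall>t\<in>{1..T}.
     (\<forall>i\<in>{1..m+1}. \<forall>j\<in>{1..n+1}. 0 \<le> W t (i, j)) \<and>
     (\<forall>j\<in>{1..n}. (\<Sum>i=1..m+1. W t (i, j)) = 1) \<and>
     (\<forall>i\<in>{1..m}. (\<Sum>j=1..n+1. W t (i, j)) = 1)}"

definition lp_objective ::
  "nat \<Rightarrow> nat \<Rightarrow> nat \<Rightarrow> real \<Rightarrow> real \<Rightarrow> (nat \<Rightarrow> nat \<times> nat \<Rightarrow> real) \<Rightarrow> (nat \<Rightarrow> nat \<times> nat \<Rightarrow> real) \<Rightarrow> real" where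
  "lp_objective T m n p \<gamma> D W =
     (\<Sum>t=1..T. \<Sum>i=1..m+1. \<Sum>j=1..n+1. D t (i, j) * W t (i, j))
     + \<gamma> powr p / 2 * (\<Sum>t=1..<T. \<Sum>i=1..m. \<Sum>j=1..n. \<bar>W (t+1) (i, j) - W t (i, j)\<bar>)"

section \<open>The multimarginal optimal transport problem\<close>

text \<open>The multi-index \<open>((i\<^sub>1, j\<^sub>1), \<dots>, (i\<^sub>T, j\<^sub>T))\<close> of a tensor entry is a function on \<open>{1..T}\<close>,
  extended by \<open>undefined\<close> so that there are only finitely many of them.\<close>

definition multi_indices :: "nat \<Rightarrow> nat \<Rightarrow> nat \<Rightarrow> (nat \<Rightarrow> nat \<times> nat) set" where
  "multi_indices T m n = ({1..T} \<rightarrow>\<^sub>E {1..m+1} \<times> {1..n+1})"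

definition marginal ::
  "nat \<Rightarrow> nat \<Rightarrow> nat \<Rightarrow> nat \<Rightarrow> ((nat \<Rightarrow> nat \<times> nat) \<Rightarrow> real) \<Rightarrow> nat \<times> nat \<Rightarrow> real" where
  "marginal T m n t M ij = (\<Sum>s | s \<in> multi_indices T m n \<and> s t = ij. M s)"

definition mu_bar :: "nat \<Rightarrow> nat \<Rightarrow> nat \<Rightarrow> real" where
  "mu_bar m n i = (if i \<le> m then 1 else real n)"

definition mu_tilde :: "nat \<Rightarrow> nat \<Rightarrow> nat \<Rightarrow> real" where
  "mu_tilde m n j = (if j \<le> n then 1 else real m)"

definition kron :: "nat \<Rightarrow> nat \<Rightarrow> real" where
  "kron i k = (if i = k then 1 else 0)"

fun F_cost :: "nat \<Rightarrow> nat \<Rightarrow> real \<Rightarrow> real \<Rightarrow> nat \<times> nat \<Rightarrow> nat \<times> nat \<Rightarrow> ereal" where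
  "F_cost m n p \<gamma> (i, j) (k, l) =
     (if i = k
      then ereal (\<gamma> powr p / 2 * (1 - kron i k * kron j l) *
             ((1 - kron k (m+1)) * (1 - kron l (n+1)) + (1 - kron i (m+1)) * (1 - kron j (n+1))))
      else \<infinity>)"

definition C_cost ::
  "nat \<Rightarrow> nat \<Rightarrow> nat \<Rightarrow> real \<Rightarrow> real \<Rightarrow> (nat \<Rightarrow> nat \<times> nat \<Rightarrow> real) \<Rightarrow> (nat \<Rightarrow> nat \<times> nat) \<Rightarrow> ereal" where
  "C_cost T m n p \<gamma> D s =
     (\<Sum>t=1..T. ereal (D t (s t))) + (\<Sum>t=1..<T. F_cost m n p \<gamma> (s t) (s (t+1)))"

definition mot_feasible :: "nat \<Rightarrow> nat \<Rightarrow> nat \<Rightarrow> ((nat \<Rightarrow> nat \<times> nat) \<Rightarrow> real) set" where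
  "mot_feasible T m n = {M.
     (\<forall>s\<in>multi_indices T m n. 0 \<le> M s) \<and>
     (\<forall>t\<in>{1..T}.
        (\<forall>i\<in>{1..m+1}. (\<Sum>j=1..n+1. marginal T m n t M (i, j)) = mu_bar m n i) \<and>
        (\<forall>j\<in>{1..n+1}. (\<Sum>i=1..m+1. marginal T m n t M (i, j)) = mu_tilde m n j))}"

text \<open>The convention \<open>\<infinity> \<cdot> 0 = 0\<close> is that of multiplication on \<^typ>\<open>ereal\<close>.\<close>

definition mot_objective ::
  "nat \<Rightarrow> nat \<Rightarrow> nat \<Rightarrow> real \<Rightarrow> real \<Rightarrow> (nat \<Rightarrow> nat \<times> nat \<Rightarrow> real) \<Rightarrow> ((nat \<Rightarrow> nat \<times> nat) \<Rightarrow> real) \<Rightarrow> ereal" where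
  "mot_objective T m n p \<gamma> D M =
     (\<Sum>s\<in>multi_indices T m n. C_cost T m n p \<gamma> D s * ereal (M s))"

end

theory Submission
  imports Defs
begin

text \<open>The two problems have the same value because marginals and gluing transfer solutions
  in both directions without raising the cost.

  Restricted to moves within a row, the switching cost \<open>F\<close> is \<open>\<gamma>\<^sup>p / 2\<close> times the \<open>\<ell>\<^sup>1\<close> distance, on the
  \<open>m \<times> n\<close> core of cells, between the unit masses at the two cells (\<open>F_cost_eq\<close>,
  \<open>star_dist_indicator\<close>). By the triangle inequality, the marginals of a feasible tensor vary over time
  by no more than the tensor pays for switching, so they form a solution of the linear programme that
  costs no more (\<open>lp_marginal_le_mot\<close>).

  For the converse, the same cost is the path metric of a star: every core cell is joined to the centre by
  an edge of length \<open>\<gamma>\<^sup>p / 2\<close>, every other cell by one of length 0. For such a metric, transporting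
  one distribution to another costs exactly their variation, which is attained by leaving the common mass
  in place and moving the excess arbitrarily (\<open>exists_star_optimal_coupling\<close>). As consecutive matrices
  have equal row sums, this can be done inside each row, where \<open>F\<close> is finite
  (\<open>exists_row_star_optimal_coupling\<close>). The couplings of consecutive times are glued to a tensor as a
  Markov chain (\<open>exists_path_measure\<close>), and its cost equals that of the given matrices
  (\<open>exists_transport_plan\<close>).

  The linear programme leaves the entry \<open>(m+1, n+1)\<close> free, while the tensor problem fixes it through the
  sums of the last row and column. As this entry has cost 0, it may be set to the required value
  (\<open>balanced_balance\<close>, \<open>lp_objective_balance\<close>). This also bounds all entries, so that the minimum
  of the linear programme is attained by compactness (\<open>exists_balanced_minimizer\<close>); the tensor
  constructed from a minimiser then attains the minimum of the transport problem.\<close>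

section \<open>Optimal transport for a star metric\<close>

text \<open>The points \<open>k\<close> are the leaves of a star, \<open>h k\<close> being the length of the edge from \<open>k\<close> to the
  centre; \<open>star_dist\<close> is then the path length between leaves.\<close>

definition star_dist :: "('k \<Rightarrow> real) \<Rightarrow> 'k \<Rightarrow> 'k \<Rightarrow> real" where
  "star_dist h k l = (if k = l then 0 else h k + h l)"

text \<open>If the edges to the points of \<open>A\<close> have length 1 and all others length 0, the star metric is the
  \<open>\<ell>\<^sup>1\<close> distance between the unit masses at \<open>k'\<close> and \<open>l\<close>, restricted to \<open>A\<close>. This is what connects
  the absolute values in the linear programme with a transport cost.\<close>

lemma star_dist_indicator:
  assumes "finite A"
  shows "(\<Sum>k\<in>A. \<bar>of_bool (l = k) - of_bool (k' = k)\<bar>) = star_dist (\<lambda>k. of_bool (k \<in> A)) k' l"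
proof (cases "k' = l")
  case False
  then have "\<bar>of_bool (l = k) - of_bool (k' = k)\<bar> = (if l = k then 1 else 0) + (if k' = k then 1 else (0::real))" for k
    by auto
  then show ?thesis
    using False assms by (simp add: star_dist_def sum.distrib)
qed (simp add: star_dist_def)

definition coupling :: "'k set \<Rightarrow> ('k \<Rightarrow> real) \<Rightarrow> ('k \<Rightarrow> real) \<Rightarrow> ('k \<Rightarrow> 'k \<Rightarrow> real) \<Rightarrow> bool" where
  "coupling K a b q \<longleftrightarrow> (\<forall>k\<in>K. \<forall>l\<in>K. 0 \<le> q k l) \<and>
     (\<forall>k\<in>K. (\<Sum>l\<in>K. q k l) = a k) \<and> (\<forall>l\<in>K. (\<Sum>k\<in>K. q k l) = b l)"

lemma couplingD:
  assumes "coupling K a b q"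
  shows "k \<in> K \<Longrightarrow> l \<in> K \<Longrightarrow> 0 \<le> q k l"
    and "k \<in> K \<Longrightarrow> (\<Sum>l\<in>K. q k l) = a k"
    and "l \<in> K \<Longrightarrow> (\<Sum>k\<in>K. q k l) = b l"
  using assms by (auto simp: coupling_def)

text \<open>For \<open>h \<ge> 0\<close> every coupling costs at least the right-hand side, since the transport cost
  dominates the weighted variation of the marginals. A coupling that attains this bound is therefore
  optimal, and here it is required to do so for all weights \<open>h\<close> at once.\<close>

definition star_optimal :: "'k set \<Rightarrow> ('k \<Rightarrow> real) \<Rightarrow> ('k \<Rightarrow> real) \<Rightarrow> ('k \<Rightarrow> 'k \<Rightarrow> real) \<Rightarrow> bool" where
  "star_optimal K a b q \<longleftrightarrow> coupling K a b q \<and>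
     (\<forall>h. (\<Sum>k\<in>K. \<Sum>l\<in>K. q k l * star_dist h k l) = (\<Sum>k\<in>K. h k * \<bar>b k - a k\<bar>))"

text \<open>The mass common to both marginals stays where it is. The excess \<open>u\<close> of \<open>a\<close> over \<open>b\<close> and
  the excess \<open>v\<close> of \<open>b\<close> over \<open>a\<close> have the same total mass \<open>R\<close> and disjoint supports, so the product
  measure \<open>u \<otimes> v / R\<close> moves one to the other without touching the diagonal. On a star any such way of
  moving is optimal: all mass passes through the centre, and the unit of mass that leaves \<open>j\<close>
  or arrives at \<open>j\<close> pays \<open>h j\<close> independently of its other end.\<close>

lemma exists_star_optimal_coupling:
  fixes a b :: "'k \<Rightarrow> real"
  assumes fin: "finite J" and a: "\<And>j. j \<in> J \<Longrightarrow> 0 \<le> a j" and b: "\<And>j. j \<in> J \<Longrightarrow> 0 \<le> b j"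
    and mass: "sum a J = sum b J"
  shows "\<exists>q. star_optimal J a b q"
proof -
  define u v where "u j = max 0 (a j - b j)" and "v j = max 0 (b j - a j)" for j
  define R where "R = sum u J"
  have u0: "0 \<le> u j" and v0: "0 \<le> v j" and uv: "u j * v j = 0" for j
    by (auto simp: u_def v_def max_def)
  have uv_diff: "u j - v j = a j - b j" and uv_abs: "u j + v j = \<bar>b j - a j\<bar>" for j
    by (auto simp: u_def v_def)
  have "sum u J - sum v J = 0"
    using mass unfolding sum_subtractf[symmetric] uv_diff by (simp add: sum_subtractf)
  then have Rv: "R = sum v J" by (simp add: R_def)
  have R0: "0 \<le> R" by (simp add: R_def sum_nonneg u0)
  \<comment> \<open>If \<open>R = 0\<close>, both excesses vanish, and the quotients are \<open>0\<close> by \<open>x / 0 = 0\<close>, as they should be.\<close>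
  have uR: "u j * R / R = u j" if "j \<in> J" for j
    using that fin u0 by (cases "R = 0") (auto simp: R_def sum_nonneg_eq_0_iff)
  have vR: "R * v j / R = v j" if "j \<in> J" for j
    using that fin v0 by (cases "R = 0") (auto simp: Rv sum_nonneg_eq_0_iff)
  define q where "q j l = (if j = l then min (a j) (b j) else 0) + u j * v l / R" for j l
  show ?thesis
    unfolding star_optimal_def coupling_def
  proof (intro exI[of _ q] conjI ballI allI)
    show "0 \<le> q j l" if "j \<in> J" "l \<in> J" for j l
      using that a b u0 v0 R0 by (simp add: q_def)
    show "(\<Sum>l\<in>J. q j l) = a j" if "j \<in> J" for j
    proof -
      have "(\<Sum>l\<in>J. q j l) = min (a j) (b j) + u j * R / R"
        using that fin by (simp add: q_def sum.distrib Rv sum_distrib_left sum_divide_distrib)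
      also have "\<dots> = a j" unfolding uR[OF that] by (simp add: u_def)
      finally show ?thesis .
    qed
    show "(\<Sum>j\<in>J. q j l) = b l" if "l \<in> J" for l
    proof -
      have "(\<Sum>j\<in>J. q j l) = min (a l) (b l) + R * v l / R"
        using that fin by (simp add: q_def sum.distrib R_def sum_distrib_right sum_divide_distrib)
      also have "\<dots> = b l" unfolding vR[OF that] by (simp add: v_def)
      finally show ?thesis .
    qed
    show "(\<Sum>j\<in>J. \<Sum>l\<in>J. q j l * star_dist h j l) = (\<Sum>j\<in>J. h j * \<bar>b j - a j\<bar>)" for h
    proof -
      have "q j l * star_dist h j l = u j * v l / R * h j + u j * v l / R * h l" for j l
        \<comment> \<open>On the diagonal, where \<open>star_dist\<close> is \<open>0\<close>, the right-hand side vanishes because \<open>u l * v l = 0\<close>.\<close>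
        using uv[of l] by (auto simp: q_def star_dist_def distrib_left)
      then have "(\<Sum>j\<in>J. \<Sum>l\<in>J. q j l * star_dist h j l)
          = (\<Sum>j\<in>J. \<Sum>l\<in>J. u j * v l / R * h j) + (\<Sum>j\<in>J. \<Sum>l\<in>J. u j * v l / R * h l)"
        by (simp add: sum.distrib)
      also have "(\<Sum>j\<in>J. \<Sum>l\<in>J. u j * v l / R * h l) = (\<Sum>l\<in>J. \<Sum>j\<in>J. u j * v l / R * h l)"
        by (rule sum.swap)
      also have "\<dots> = (\<Sum>l\<in>J. R * v l / R * h l)"
        by (simp add: R_def sum_distrib_right sum_divide_distrib)
      also have "(\<Sum>j\<in>J. \<Sum>l\<in>J. u j * v l / R * h j) = (\<Sum>j\<in>J. u j * R / R * h j)"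
        by (simp add: Rv sum_distrib_right sum_distrib_left sum_divide_distrib)
      also have "(\<Sum>j\<in>J. u j * R / R * h j) + (\<Sum>l\<in>J. R * v l / R * h l)
          = (\<Sum>j\<in>J. h j * \<bar>b j - a j\<bar>)"
        unfolding sum.distrib[symmetric] uv_abs[symmetric]
        by (rule sum.cong) (simp_all only: uR vR, simp add: algebra_simps)
      finally show ?thesis .
    qed
  qed
qed

text \<open>If \<open>a\<close> and \<open>b\<close> have the same mass in every row, the rows can be coupled one by one. The weighted
  variation is a sum over rows, so nothing is lost by forbidding mass to change its row, and the
  infinite cost for changing rows can be avoided.\<close>

lemma exists_row_star_optimal_coupling:
  fixes a b :: "'i \<times> 'j \<Rightarrow> real"
  assumes fin: "finite I" "finite J"
    and a: "\<And>k. k \<in> I \<times> J \<Longrightarrow> 0 \<le> a k" and b: "\<And>k. k \<in> I \<times> J \<Longrightarrow> 0 \<le> b k"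
    and mass: "\<And>i. i \<in> I \<Longrightarrow> (\<Sum>j\<in>J. a (i, j)) = (\<Sum>j\<in>J. b (i, j))"
  shows "\<exists>q. star_optimal (I \<times> J) a b q \<and> (\<forall>k l. fst k \<noteq> fst l \<longrightarrow> q k l = 0)"
proof -
  have "\<forall>i\<in>I. \<exists>q. star_optimal J (\<lambda>j. a (i, j)) (\<lambda>j. b (i, j)) q"
    using fin a b mass by (intro ballI exists_star_optimal_coupling) auto
  then obtain r where star: "\<And>i. i \<in> I \<Longrightarrow> star_optimal J (\<lambda>j. a (i, j)) (\<lambda>j. b (i, j)) (r i)"
    by metis
  then have "\<And>i. i \<in> I \<Longrightarrow> coupling J (\<lambda>j. a (i, j)) (\<lambda>j. b (i, j)) (r i)"
    by (simp add: star_optimal_def)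
  note r = couplingD[OF this]
  have r_cost: "(\<Sum>j\<in>J. \<Sum>l\<in>J. r i j l * star_dist h j l) = (\<Sum>j\<in>J. h j * \<bar>b (i, j) - a (i, j)\<bar>)"
    if "i \<in> I" for i h
    using star[OF that] by (simp add: star_optimal_def)
  define q where "q k l = (if fst k = fst l then r (fst k) (snd k) (snd l) else 0)" for k l
  have one_row: "(\<Sum>l\<in>I \<times> J. if i = fst l then f l else 0) = (\<Sum>j\<in>J. f (i, j))"
    if "i \<in> I" for i and f :: "'i \<times> 'j \<Rightarrow> real"
  proof -
    have "(\<Sum>l\<in>I \<times> J. if i = fst l then f l else 0)
        = (\<Sum>k\<in>I. \<Sum>j\<in>J. if i = k then f (k, j) else 0)"
      unfolding sum.cartesian_product by (rule sum.cong) auto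
    also have "\<dots> = (\<Sum>k\<in>I. if i = k then \<Sum>j\<in>J. f (k, j) else 0)"
      by (rule sum.cong) auto
    finally show ?thesis using that fin by simp
  qed
  show ?thesis
    unfolding star_optimal_def coupling_def
  proof (intro exI[of _ q] conjI ballI allI impI)
    show "0 \<le> q k l" if "k \<in> I \<times> J" "l \<in> I \<times> J" for k l
      using that r(1) by (auto simp: q_def)
    show "q k l = 0" if "fst k \<noteq> fst l" for k l
      using that by (simp add: q_def)
    show "(\<Sum>l\<in>I \<times> J. q k l) = a k" if "k \<in> I \<times> J" for k
      using that one_row[of "fst k" "\<lambda>l. r (fst k) (snd k) (snd l)"] r(2) by (auto simp: q_def)
    show "(\<Sum>k\<in>I \<times> J. q k l) = b l" if "l \<in> I \<times> J" for l
    proof -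
      have "(\<Sum>k\<in>I \<times> J. q k l) = (\<Sum>k\<in>I \<times> J. if fst l = fst k then r (fst l) (snd k) (snd l) else 0)"
        by (rule sum.cong) (auto simp: q_def)
      then show ?thesis
        using that one_row[of "fst l" "\<lambda>k. r (fst l) (snd k) (snd l)"] r(3) by auto
    qed
    show "(\<Sum>k\<in>I \<times> J. \<Sum>l\<in>I \<times> J. q k l * star_dist h k l) = (\<Sum>k\<in>I \<times> J. h k * \<bar>b k - a k\<bar>)" for h
    proof -
      have "(\<Sum>l\<in>I \<times> J. q (i, j) l * star_dist h (i, j) l)
          = (\<Sum>l\<in>J. r i j l * star_dist (\<lambda>j. h (i, j)) j l)" if "i \<in> I" for i j
      proof -
        have "(\<Sum>l\<in>I \<times> J. q (i, j) l * star_dist h (i, j) l)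
            = (\<Sum>l\<in>I \<times> J. if i = fst l then r i j (snd l) * star_dist h (i, j) l else 0)"
          by (rule sum.cong) (auto simp: q_def)
        then show ?thesis
          using one_row[OF that] by (simp add: star_dist_def)
      qed
      then have "(\<Sum>k\<in>I \<times> J. \<Sum>l\<in>I \<times> J. q k l * star_dist h k l)
          = (\<Sum>i\<in>I. \<Sum>j\<in>J. \<Sum>l\<in>J. r i j l * star_dist (\<lambda>j. h (i, j)) j l)"
        by (subst sum.cartesian_product) (auto intro!: sum.cong)
      also have "\<dots> = (\<Sum>k\<in>I \<times> J. h k * \<bar>b k - a k\<bar>)"
        by (subst sum.cartesian_product') (simp add: r_cost)
      finally show ?thesis .
    qed
  qed
qed

section \<open>Gluing couplings along a chain\<close>

lemma sum_paths_Suc: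
  "(\<Sum>s\<in>{1..Suc T} \<rightarrow>\<^sub>E K. \<phi> s) = (\<Sum>s\<in>{1..T} \<rightarrow>\<^sub>E K. \<Sum>y\<in>K. \<phi> (s(Suc T := y)))"
proof -
  have "{1..Suc T} \<rightarrow>\<^sub>E K = (\<lambda>(y, s). s(Suc T := y)) ` (K \<times> ({1..T} \<rightarrow>\<^sub>E K))"
    using PiE_insert_eq[of "Suc T" "{1..T}" "\<lambda>_. K"] by (simp add: atLeastAtMostSuc_conv)
  moreover have "inj_on (\<lambda>(y, s). s(Suc T := y)) (K \<times> ({1..T} \<rightarrow>\<^sub>E K))"
    using inj_combinator[of "Suc T" "{1..T}" "\<lambda>_. K"] by simp
  ultimately have "(\<Sum>s\<in>{1..Suc T} \<rightarrow>\<^sub>E K. \<phi> s)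
      = (\<Sum>(y, s)\<in>K \<times> ({1..T} \<rightarrow>\<^sub>E K). \<phi> (s(Suc T := y)))"
    by (simp add: sum.reindex comp_def split_def)
  also have "\<dots> = (\<Sum>y\<in>K. \<Sum>s\<in>{1..T} \<rightarrow>\<^sub>E K. \<phi> (s(Suc T := y)))"
    by (simp add: sum.cartesian_product)
  also have "\<dots> = (\<Sum>s\<in>{1..T} \<rightarrow>\<^sub>E K. \<Sum>y\<in>K. \<phi> (s(Suc T := y)))"
    by (rule sum.swap)
  finally show ?thesis .
qed

text \<open>\<open>M\<close> is the law of a path with one-time marginals \<open>a t\<close> and law \<open>q t\<close> of the pair of positions
  at times \<open>t\<close> and \<open>t + 1\<close>. Both are expressed by integrating test functions, which is the form in
  which costs are evaluated; indicators give back the entries.\<close>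

definition path_measure ::
  "nat \<Rightarrow> 'k set \<Rightarrow> (nat \<Rightarrow> 'k \<Rightarrow> real) \<Rightarrow> (nat \<Rightarrow> 'k \<Rightarrow> 'k \<Rightarrow> real) \<Rightarrow> ((nat \<Rightarrow> 'k) \<Rightarrow> real) \<Rightarrow> bool" where
  "path_measure T K a q M \<longleftrightarrow> (\<forall>s\<in>{1..T} \<rightarrow>\<^sub>E K. 0 \<le> M s) \<and>
    (\<forall>t\<in>{1..T}. \<forall>f. (\<Sum>s\<in>{1..T} \<rightarrow>\<^sub>E K. M s * f (s t)) = (\<Sum>k\<in>K. a t k * f k)) \<and>
    (\<forall>t\<in>{1..<T}. \<forall>g.
       (\<Sum>s\<in>{1..T} \<rightarrow>\<^sub>E K. M s * g (s t) (s (t+1))) = (\<Sum>k\<in>K. \<Sum>l\<in>K. q t k l * g k l))"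

lemma path_measureD:
  assumes "path_measure T K a q M"
  shows "s \<in> {1..T} \<rightarrow>\<^sub>E K \<Longrightarrow> 0 \<le> M s"
    and "t \<in> {1..T} \<Longrightarrow> (\<Sum>s\<in>{1..T} \<rightarrow>\<^sub>E K. M s * f (s t)) = (\<Sum>k\<in>K. a t k * f k)"
    and "t \<in> {1..<T} \<Longrightarrow>
      (\<Sum>s\<in>{1..T} \<rightarrow>\<^sub>E K. M s * g (s t) (s (t+1))) = (\<Sum>k\<in>K. \<Sum>l\<in>K. q t k l * g k l)"
  using assms unfolding path_measure_def by (elim conjE, blast)+

text \<open>Couplings of consecutive marginals are glued to a Markov chain: a path that ends in \<open>k\<close>
  at time \<open>T\<close> is continued to \<open>l\<close> with the conditional probability \<open>q T k l / a T k\<close>. Where \<open>a T k = 0\<close>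
  this quotient is \<open>0\<close>, which is harmless because then neither \<open>M\<close> nor \<open>q T\<close> has mass at \<open>k\<close>.\<close>

lemma exists_path_measure:
  fixes a :: "nat \<Rightarrow> 'k \<Rightarrow> real"
  assumes "1 \<le> T" and fin: "finite K"
    and "\<And>t k. t \<in> {1..T} \<Longrightarrow> k \<in> K \<Longrightarrow> 0 \<le> a t k"
    and "\<And>t. t \<in> {1..<T} \<Longrightarrow> coupling K (a t) (a (t+1)) (q t)"
  shows "\<exists>M. path_measure T K a q M"
  using assms(1,3-)
proof (induction T rule: nat_induct_at_least)
  case base
  have "{1..0::nat} \<rightarrow>\<^sub>E K = {\<lambda>_. undefined}" by simp
  then have "(\<Sum>s\<in>{1..1} \<rightarrow>\<^sub>E K. \<phi> s) = (\<Sum>y\<in>K. \<phi> ((\<lambda>_. undefined)(1 := y)))" for \<phi> :: "(nat \<Rightarrow> 'k) \<Rightarrow> real"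
    using sum_paths_Suc[of \<phi> 0 K] by (simp add: fun_upd_def)
  then show ?case
    using base by (intro exI[of _ "\<lambda>s. a 1 (s 1)"]) (auto simp: path_measure_def PiE_iff)
next
  case (Suc T)
  let ?S = "{1..T} \<rightarrow>\<^sub>E K" and ?S' = "{1..Suc T} \<rightarrow>\<^sub>E K"
  have "\<exists>M. path_measure T K a q M"
    by (rule Suc.IH; rule Suc.prems) auto
  then obtain M where "path_measure T K a q M" ..
  note M0 = path_measureD(1)[OF this] and M1 = path_measureD(2)[OF this] and M2 = path_measureD(3)[OF this]
  have T: "T \<in> {1..T}" "T \<in> {1..<Suc T}" using Suc.hyps by auto
  note q = couplingD[OF Suc.prems(2)[OF T(2)]]
  have finS: "finite ?S" using fin by (simp add: finite_PiE)
  define M' where "M' s = M (restrict s {1..T}) * (q T (s T) (s (Suc T)) / a T (s T))" for s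
  have M'_upd: "M' (s(Suc T := y)) = M s * (q T (s T) y / a T (s T))" if "s \<in> ?S" for s y
  proof -
    have "restrict (s(Suc T := y)) {1..T} = s"
      using that by (auto simp: restrict_def PiE_iff extensional_def)
    then show ?thesis by (simp add: M'_def)
  qed
  \<comment> \<open>The two facts that settle the states \<open>k\<close> with \<open>a T k = 0\<close>.\<close>
  have q_null: "q T k l = 0" if "a T k = 0" "k \<in> K" "l \<in> K" for k l
    using that q(1,2) fin by (metis sum_nonneg_eq_0_iff)
  have M_null: "M s = 0" if "s \<in> ?S" "a T (s T) = 0" for s
  proof -
    have sT: "s T \<in> K" using that T by (auto simp: PiE_iff)
    have "(\<Sum>s'\<in>?S. M s' * of_bool (s' T = s T)) = (\<Sum>k\<in>K. a T k * of_bool (k = s T))"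
      using M1[OF T(1), of "\<lambda>k. of_bool (k = s T)"] by simp
    also have "\<dots> = (\<Sum>k\<in>K. 0)" using that by (intro sum.cong) auto
    finally have "M s * of_bool (s T = s T) = 0"
      using finS M0 that(1) by (subst (asm) sum.neutral_const, subst (asm) sum_nonneg_eq_0_iff) auto
    then show ?thesis by simp
  qed
  have M'_total: "(\<Sum>y\<in>K. M' (s(Suc T := y))) = M s" if "s \<in> ?S" for s
  proof -
    have sT: "s T \<in> K" using that T by (auto simp: PiE_iff)
    have "(\<Sum>y\<in>K. M' (s(Suc T := y))) = M s * (a T (s T) / a T (s T))"
      using that q(2)[OF sT]
      by (simp add: M'_upd flip: sum_distrib_left sum_divide_distrib)
    also have "\<dots> = M s" using M_null[OF that] by (cases "a T (s T) = 0") auto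
    finally show ?thesis .
  qed
  \<comment> \<open>Continuing the paths does not change integrals of functions of the first \<open>T\<close> positions.\<close>
  have past: "(\<Sum>s\<in>?S'. M' s * \<psi> s) = (\<Sum>s\<in>?S. M s * \<psi> s)"
    if "\<And>s y. \<psi> (s(Suc T := y)) = \<psi> s" for \<psi> :: "(nat \<Rightarrow> 'k) \<Rightarrow> real"
    unfolding sum_paths_Suc by (rule sum.cong) (simp_all add: that M'_total flip: sum_distrib_right)
  have last: "(\<Sum>s\<in>?S'. M' s * g (s T) (s (Suc T))) = (\<Sum>k\<in>K. \<Sum>l\<in>K. q T k l * g k l)"
    for g :: "'k \<Rightarrow> 'k \<Rightarrow> real"
  proof -
    have "(\<Sum>s\<in>?S'. M' s * g (s T) (s (Suc T)))
        = (\<Sum>s\<in>?S. M s * (\<Sum>y\<in>K. q T (s T) y / a T (s T) * g (s T) y))"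
      unfolding sum_paths_Suc by (rule sum.cong) (simp_all add: M'_upd sum_distrib_left mult.assoc)
    also have "\<dots> = (\<Sum>k\<in>K. a T k * (\<Sum>y\<in>K. q T k y / a T k * g k y))"
      by (rule M1[OF T(1)])
    also have "\<dots> = (\<Sum>k\<in>K. \<Sum>l\<in>K. q T k l * g k l)"
      unfolding sum_distrib_left using q_null by (intro sum.cong) auto
    finally show ?thesis .
  qed
  show ?case
    unfolding path_measure_def
  proof (intro exI[of _ M'] conjI ballI allI)
    fix s assume s: "s \<in> ?S'"
    then have "restrict s {1..T} \<in> ?S" "s T \<in> K" "s (Suc T) \<in> K"
      using T by (auto simp: PiE_iff)
    then show "0 \<le> M' s"
      using M0 Suc.prems(1)[of T] q(1) T by (simp add: M'_def)
  next
    fix t and f :: "'k \<Rightarrow> real" assume t: "t \<in> {1..Suc T}"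
    show "(\<Sum>s\<in>?S'. M' s * f (s t)) = (\<Sum>k\<in>K. a t k * f k)"
    proof (cases "t = Suc T")
      case True
      have "(\<Sum>s\<in>?S'. M' s * f (s t)) = (\<Sum>k\<in>K. \<Sum>l\<in>K. q T k l * f l)"
        using last[of "\<lambda>_. f"] True by simp
      also have "\<dots> = (\<Sum>l\<in>K. (\<Sum>k\<in>K. q T k l) * f l)"
        unfolding sum_distrib_right by (rule sum.swap)
      finally show ?thesis using q(3) True by simp
    next
      case False
      then show ?thesis using past[of "\<lambda>s. f (s t)"] M1[of t f] t by simp
    qed
  next
    fix t and g :: "'k \<Rightarrow> 'k \<Rightarrow> real" assume t: "t \<in> {1..<Suc T}"
    show "(\<Sum>s\<in>?S'. M' s * g (s t) (s (t+1))) = (\<Sum>k\<in>K. \<Sum>l\<in>K. q t k l * g k l)"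
    proof (cases "t = T")
      case True
      then show ?thesis using last by simp
    next
      case False
      then show ?thesis using past[of "\<lambda>s. g (s t) (s (t+1))"] M2[of t g] t by simp
    qed
  qed
qed

section \<open>The tensor cost in terms of the star metric\<close>

abbreviation cells :: "nat \<Rightarrow> nat \<Rightarrow> (nat \<times> nat) set" where
  "cells m n \<equiv> {1..m+1} \<times> {1..n+1}"

abbreviation core :: "nat \<Rightarrow> nat \<Rightarrow> (nat \<times> nat) set" where
  "core m n \<equiv> {1..m} \<times> {1..n}"

abbreviation in_core :: "nat \<Rightarrow> nat \<Rightarrow> nat \<times> nat \<Rightarrow> real" where
  "in_core m n k \<equiv> of_bool (k \<in> core m n)"

definition row_constant :: "nat \<Rightarrow> (nat \<Rightarrow> nat \<times> nat) \<Rightarrow> bool" where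
  "row_constant T s \<longleftrightarrow> (\<forall>t\<in>{1..<T}. fst (s t) = fst (s (t+1)))"

text \<open>The finite part of the tensor cost: its value on multi-indices that never change row.\<close>

definition path_cost ::
  "nat \<Rightarrow> nat \<Rightarrow> nat \<Rightarrow> real \<Rightarrow> real \<Rightarrow> (nat \<Rightarrow> nat \<times> nat \<Rightarrow> real) \<Rightarrow> (nat \<Rightarrow> nat \<times> nat) \<Rightarrow> real" where
  "path_cost T m n p \<gamma> D s =
     (\<Sum>t=1..T. D t (s t)) + (\<Sum>t=1..<T. \<gamma> powr p / 2 * star_dist (in_core m n) (s t) (s (t+1)))"

lemma multi_indices_cell: "s \<in> multi_indices T m n \<Longrightarrow> t \<in> {1..T} \<Longrightarrow> s t \<in> cells m n"
  by (auto simp: multi_indices_def PiE_iff)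

lemma finite_multi_indices [simp]: "finite (multi_indices T m n)"
  by (simp add: multi_indices_def finite_PiE)

text \<open>Within one row \<open>F\<close> is a star metric with the edges of length \<open>\<gamma>\<^sup>p / 2\<close> for the core
  cells, those that assign a trajectory to a trajectory, and edges of length 0 for the others.\<close>

lemma F_cost_eq:
  assumes "k \<in> cells m n" "l \<in> cells m n"
  shows "F_cost m n p \<gamma> k l =
    (if fst k = fst l then ereal (\<gamma> powr p / 2 * star_dist (in_core m n) k l) else \<infinity>)"
  using assms by (cases k; cases l) (auto simp: kron_def star_dist_def)

lemma C_cost_eq:
  assumes s: "s \<in> multi_indices T m n"
  shows "C_cost T m n p \<gamma> D s = (if row_constant T s then ereal (path_cost T m n p \<gamma> D s) else \<infinity>)"
proof -
  have F: "F_cost m n p \<gamma> (s t) (s (t+1)) = (if fst (s t) = fst (s (t+1))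
      then ereal (\<gamma> powr p / 2 * star_dist (in_core m n) (s t) (s (t+1))) else \<infinity>)"
    if "t \<in> {1..<T}" for t
    using that by (intro F_cost_eq multi_indices_cell[OF s]) auto
  show ?thesis
  proof (cases "row_constant T s")
    case True
    then have "(\<Sum>t=1..<T. F_cost m n p \<gamma> (s t) (s (t+1)))
        = (\<Sum>t=1..<T. ereal (\<gamma> powr p / 2 * star_dist (in_core m n) (s t) (s (t+1))))"
      by (intro sum.cong refl, subst F) (auto simp: row_constant_def)
    with True show ?thesis
      by (simp add: C_cost_def path_cost_def)
  next
    case False
    then have "(\<Sum>t=1..<T. F_cost m n p \<gamma> (s t) (s (t+1))) = \<infinity>"
      unfolding sum_Pinfty row_constant_def using F by fastforce
    with False show ?thesis
      by (simp add: C_cost_def)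
  qed
qed

lemma mot_objective_eq:
  assumes "\<And>s. s \<in> multi_indices T m n \<Longrightarrow> 0 \<le> M s"
  shows "mot_objective T m n p \<gamma> D M =
    (if \<forall>s\<in>multi_indices T m n. M s \<noteq> 0 \<longrightarrow> row_constant T s
     then ereal (\<Sum>s\<in>multi_indices T m n. path_cost T m n p \<gamma> D s * M s) else \<infinity>)"
proof (cases "\<forall>s\<in>multi_indices T m n. M s \<noteq> 0 \<longrightarrow> row_constant T s")
  case True
  then have "mot_objective T m n p \<gamma> D M
      = (\<Sum>s\<in>multi_indices T m n. ereal (path_cost T m n p \<gamma> D s * M s))"
    unfolding mot_objective_def by (intro sum.cong) (auto simp: C_cost_eq)
  with True show ?thesis by simp
next
  case False
  then obtain s where "s \<in> multi_indices T m n" "M s \<noteq> 0" "\<not> row_constant T s" by blast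
  moreover from this have "0 < M s" using assms[of s] by simp
  ultimately have "\<exists>s\<in>multi_indices T m n. C_cost T m n p \<gamma> D s * ereal (M s) = \<infinity>"
    by (intro bexI[of _ s]) (simp_all add: C_cost_eq)
  then have "mot_objective T m n p \<gamma> D M = \<infinity>"
    unfolding mot_objective_def sum_Pinfty by simp
  with False show ?thesis by simp
qed

section \<open>Marginals of a tensor are feasible for the linear programme and cost no more\<close>

lemma lp_objective_eq:
  "lp_objective T m n p \<gamma> D W =
     (\<Sum>t=1..T. \<Sum>k\<in>cells m n. D t k * W t k)
     + (\<Sum>t=1..<T. \<gamma> powr p / 2 * (\<Sum>k\<in>core m n. \<bar>W (t+1) k - W t k\<bar>))"
  by (simp only: lp_objective_def sum.cartesian_product' sum_distrib_left)

lemma marginal_eq: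
  "marginal T m n t M k = (\<Sum>s\<in>multi_indices T m n. M s * of_bool (s t = k))"
proof -
  have "marginal T m n t M k = (\<Sum>s\<in>multi_indices T m n. if s t = k then M s else 0)"
    by (simp add: marginal_def sum.inter_filter)
  also have "\<dots> = (\<Sum>s\<in>multi_indices T m n. M s * of_bool (s t = k))"
    by (rule sum.cong) auto
  finally show ?thesis .
qed

lemma sum_marginal:
  assumes "t \<in> {1..T}"
  shows "(\<Sum>k\<in>cells m n. f k * marginal T m n t M k) = (\<Sum>s\<in>multi_indices T m n. f (s t) * M s)"
proof -
  have cell: "(\<lambda>s. s t) ` multi_indices T m n \<subseteq> cells m n"
    by (rule image_subsetI) (rule multi_indices_cell[OF _ assms])
  have "(\<Sum>s\<in>multi_indices T m n. f (s t) * M s)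
      = (\<Sum>k\<in>cells m n. \<Sum>s | s \<in> multi_indices T m n \<and> s t = k. f (s t) * M s)"
    by (rule sum.group[OF _ _ cell, symmetric]) simp_all
  then show ?thesis
    by (simp add: marginal_def sum_distrib_left)
qed

lemma lp_feasible_marginal:
  assumes "M \<in> mot_feasible T m n"
  shows "(\<lambda>t. marginal T m n t M) \<in> lp_feasible T m n"
  using assms by (auto simp: mot_feasible_def lp_feasible_def mu_bar_def mu_tilde_def marginal_def
      intro!: sum_nonneg)

text \<open>The difference of two marginals averages, over the multi-indices, the difference of the unit masses
  at the two positions, so the triangle inequality bounds its \<open>\<ell>\<^sup>1\<close> norm on the core by
  the average star distance.\<close>

lemma sum_abs_diff_marginal_le:
  assumes "\<And>s. s \<in> multi_indices T m n \<Longrightarrow> 0 \<le> M s"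
  shows "(\<Sum>k\<in>core m n. \<bar>marginal T m n (t+1) M k - marginal T m n t M k\<bar>)
    \<le> (\<Sum>s\<in>multi_indices T m n. M s * star_dist (in_core m n) (s t) (s (t+1)))"
proof -
  let ?S = "multi_indices T m n"
  have "(\<Sum>k\<in>core m n. \<bar>marginal T m n (t+1) M k - marginal T m n t M k\<bar>)
      \<le> (\<Sum>k\<in>core m n. \<Sum>s\<in>?S. M s * \<bar>of_bool (s (t+1) = k) - of_bool (s t = k)\<bar>)"
  proof (rule sum_mono)
    fix k
    have "\<bar>marginal T m n (t+1) M k - marginal T m n t M k\<bar>
        = \<bar>\<Sum>s\<in>?S. M s * (of_bool (s (t+1) = k) - of_bool (s t = k))\<bar>"
      by (simp add: marginal_eq right_diff_distrib sum_subtractf)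
    also have "\<dots> \<le> (\<Sum>s\<in>?S. \<bar>M s * (of_bool (s (t+1) = k) - of_bool (s t = k))\<bar>)"
      by (rule sum_abs)
    also have "\<dots> = (\<Sum>s\<in>?S. M s * \<bar>of_bool (s (t+1) = k) - of_bool (s t = k)\<bar>)"
      using assms by (intro sum.cong) (auto simp: abs_mult)
    finally show "\<bar>marginal T m n (t+1) M k - marginal T m n t M k\<bar>
        \<le> (\<Sum>s\<in>?S. M s * \<bar>of_bool (s (t+1) = k) - of_bool (s t = k)\<bar>)" .
  qed
  also have "\<dots> = (\<Sum>s\<in>?S. M s * (\<Sum>k\<in>core m n. \<bar>of_bool (s (t+1) = k) - of_bool (s t = k)\<bar>))"
    unfolding sum_distrib_left by (rule sum.swap)
  finally show ?thesis
    by (simp only: star_dist_indicator[OF finite_cartesian_product] finite_atLeastAtMost)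
qed

lemma sum_path_cost:
  "(\<Sum>s\<in>multi_indices T m n. path_cost T m n p \<gamma> D s * M s) =
     (\<Sum>t=1..T. \<Sum>k\<in>cells m n. D t k * marginal T m n t M k)
     + (\<Sum>t=1..<T. \<gamma> powr p / 2 *
          (\<Sum>s\<in>multi_indices T m n. M s * star_dist (in_core m n) (s t) (s (t+1))))"
proof -
  let ?S = "multi_indices T m n"
  have "path_cost T m n p \<gamma> D s * M s = (\<Sum>t=1..T. D t (s t) * M s)
      + (\<Sum>t=1..<T. \<gamma> powr p / 2 * (M s * star_dist (in_core m n) (s t) (s (t+1))))" for s
    unfolding path_cost_def distrib_right sum_distrib_right by (simp only: mult_ac)
  then have "(\<Sum>s\<in>?S. path_cost T m n p \<gamma> D s * M s)
      = (\<Sum>s\<in>?S. \<Sum>t=1..T. D t (s t) * M s)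
        + (\<Sum>s\<in>?S. \<Sum>t=1..<T. \<gamma> powr p / 2 * (M s * star_dist (in_core m n) (s t) (s (t+1))))"
    by (simp only: sum.distrib)
  also have "(\<Sum>s\<in>?S. \<Sum>t=1..T. D t (s t) * M s) = (\<Sum>t=1..T. \<Sum>s\<in>?S. D t (s t) * M s)"
    by (rule sum.swap)
  also have "\<dots> = (\<Sum>t=1..T. \<Sum>k\<in>cells m n. D t k * marginal T m n t M k)"
    by (intro sum.cong refl sum_marginal[symmetric])
  also have "(\<Sum>s\<in>?S. \<Sum>t=1..<T. \<gamma> powr p / 2 * (M s * star_dist (in_core m n) (s t) (s (t+1))))
      = (\<Sum>t=1..<T. \<gamma> powr p / 2 * (\<Sum>s\<in>?S. M s * star_dist (in_core m n) (s t) (s (t+1))))"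
    unfolding sum_distrib_left by (rule sum.swap)
  finally show ?thesis .
qed

text \<open>The costs \<open>D\<close> contribute equally to both objectives, and the switching terms are compared by
  \<open>sum_abs_diff_marginal_le\<close>. A tensor with mass on multi-indices that change row has infinite cost.\<close>

lemma lp_marginal_le_mot:
  assumes "M \<in> mot_feasible T m n"
  shows "ereal (lp_objective T m n p \<gamma> D (\<lambda>t. marginal T m n t M)) \<le> mot_objective T m n p \<gamma> D M"
proof -
  have M0: "\<And>s. s \<in> multi_indices T m n \<Longrightarrow> 0 \<le> M s"
    using assms by (simp add: mot_feasible_def)
  have "lp_objective T m n p \<gamma> D (\<lambda>t. marginal T m n t M)
      \<le> (\<Sum>s\<in>multi_indices T m n. path_cost T m n p \<gamma> D s * M s)"
    unfolding lp_objective_eq sum_path_cost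
    using sum_abs_diff_marginal_le[OF M0] by (intro add_left_mono sum_mono mult_left_mono) auto
  then show ?thesis
    by (simp add: mot_objective_eq M0)
qed

section \<open>Realising a balanced solution of the linear programme by a tensor\<close>

text \<open>The matrix constraints that the tensor problem puts on its marginals. They differ from those of the
  linear programme by also prescribing the sums of the last row and of the last column.\<close>

definition balanced :: "nat \<Rightarrow> nat \<Rightarrow> nat \<Rightarrow> (nat \<Rightarrow> nat \<times> nat \<Rightarrow> real) \<Rightarrow> bool" where
  "balanced T m n W \<longleftrightarrow> (\<forall>t\<in>{1..T}.
     (\<forall>k\<in>cells m n. 0 \<le> W t k) \<and>
     (\<forall>i\<in>{1..m+1}. (\<Sum>j=1..n+1. W t (i, j)) = mu_bar m n i) \<and>
     (\<forall>j\<in>{1..n+1}. (\<Sum>i=1..m+1. W t (i, j)) = mu_tilde m n j))"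

lemma balancedD:
  assumes "balanced T m n W" "t \<in> {1..T}"
  shows "k \<in> cells m n \<Longrightarrow> 0 \<le> W t k"
    and "i \<in> {1..m+1} \<Longrightarrow> (\<Sum>j=1..n+1. W t (i, j)) = mu_bar m n i"
    and "j \<in> {1..n+1} \<Longrightarrow> (\<Sum>i=1..m+1. W t (i, j)) = mu_tilde m n j"
  using assms unfolding balanced_def by blast+

lemma balanced_imp_lp_feasible: "balanced T m n W \<Longrightarrow> W \<in> lp_feasible T m n"
  by (auto simp: balanced_def lp_feasible_def mu_bar_def mu_tilde_def)

text \<open>Consecutive matrices of a balanced \<open>W\<close> have equal row sums, hence star-optimal couplings within
  rows. Gluing them gives a tensor whose switching cost at each step is exactly the variation of \<open>W\<close> on
  the core.\<close>

lemma exists_transport_plan: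
  assumes "1 \<le> T" and W: "balanced T m n W"
  obtains M where "M \<in> mot_feasible T m n"
    and "mot_objective T m n p \<gamma> D M = ereal (lp_objective T m n p \<gamma> D W)"
proof -
  let ?K = "cells m n" and ?S = "multi_indices T m n"
  note W = balancedD[OF W]
  have fin: "finite ?K" by simp
  have "\<exists>q. star_optimal ?K (W t) (W (t+1)) q \<and> (\<forall>k l. fst k \<noteq> fst l \<longrightarrow> q k l = 0)"
    if "t \<in> {1..<T}" for t
  proof (rule exists_row_star_optimal_coupling)
    have t: "t \<in> {1..T}" "t+1 \<in> {1..T}" using that by auto
    show "0 \<le> W t k" "0 \<le> W (t+1) k" if "k \<in> ?K" for k
      using W(1)[OF t(1) that] W(1)[OF t(2) that] .
    show "(\<Sum>j=1..n+1. W t (i, j)) = (\<Sum>j=1..n+1. W (t+1) (i, j))" if "i \<in> {1..m+1}" for i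
      using W(2)[OF t(1) that] W(2)[OF t(2) that] by simp
  qed simp_all
  then obtain q where star: "\<And>t. t \<in> {1..<T} \<Longrightarrow> star_optimal ?K (W t) (W (t+1)) (q t)"
    and q_row: "\<And>t k l. t \<in> {1..<T} \<Longrightarrow> fst k \<noteq> fst l \<Longrightarrow> q t k l = 0"
    by metis
  have q_cost: "(\<Sum>k\<in>?K. \<Sum>l\<in>?K. q t k l * star_dist h k l) = (\<Sum>k\<in>?K. h k * \<bar>W (t+1) k - W t k\<bar>)"
    if "t \<in> {1..<T}" for t h
    using star[OF that] unfolding star_optimal_def by blast
  have "\<exists>M. path_measure T ?K W q M"
    using assms(1) fin W(1) star unfolding star_optimal_def by (intro exists_path_measure) blast+
  then obtain M where "path_measure T ?K W q M" ..
  note M = path_measureD[OF this, folded multi_indices_def]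
  note M0 = M(1) and M1 = M(2) and M2 = M(3)
  have marg: "marginal T m n t M k = W t k" if t: "t \<in> {1..T}" and "k \<in> ?K" for t k
  proof -
    have "marginal T m n t M k = (\<Sum>l\<in>?K. W t l * of_bool (l = k))"
      unfolding marginal_eq by (rule M1[OF t])
    also have "\<dots> = (\<Sum>l\<in>?K. if l = k then W t l else 0)"
      by (rule sum.cong) auto
    also have "\<dots> = W t k" using that by simp
    finally show ?thesis .
  qed
  have "row_constant T s" if s: "s \<in> ?S" "M s \<noteq> 0" for s
    unfolding row_constant_def
  proof (intro ballI, rule ccontr)
    fix t assume t: "t \<in> {1..<T}" and "fst (s t) \<noteq> fst (s (t+1))"
    let ?g = "\<lambda>k l :: nat \<times> nat. of_bool (fst k \<noteq> fst l) :: real"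
    have "(\<Sum>s\<in>?S. M s * ?g (s t) (s (t+1))) = 0"
      unfolding M2[OF t, where g = ?g] using q_row[OF t] by (intro sum.neutral ballI) auto
    then have "M s * ?g (s t) (s (t+1)) = 0"
      using s(1) M0 by (subst (asm) sum_nonneg_eq_0_iff) auto
    with s(2) \<open>fst (s t) \<noteq> fst (s (t+1))\<close> show False by simp
  qed
  then have "mot_objective T m n p \<gamma> D M = ereal (\<Sum>s\<in>?S. path_cost T m n p \<gamma> D s * M s)"
    by (simp add: mot_objective_eq M0)
  also have "(\<Sum>s\<in>?S. path_cost T m n p \<gamma> D s * M s) = lp_objective T m n p \<gamma> D W"
  proof -
    have "(\<Sum>s\<in>?S. M s * star_dist (in_core m n) (s t) (s (t+1)))
        = (\<Sum>k\<in>core m n. \<bar>W (t+1) k - W t k\<bar>)" if t: "t \<in> {1..<T}" for t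
    proof -
      have "(\<Sum>s\<in>?S. M s * star_dist (in_core m n) (s t) (s (t+1)))
          = (\<Sum>k\<in>?K. in_core m n k * \<bar>W (t+1) k - W t k\<bar>)"
        unfolding M2[OF t, where g = "star_dist (in_core m n)"] by (rule q_cost[OF t])
      also have "\<dots> = (\<Sum>k\<in>core m n. \<bar>W (t+1) k - W t k\<bar>)"
        by (rule sum.mono_neutral_cong_right) auto
      finally show ?thesis .
    qed
    then show ?thesis
      unfolding sum_path_cost lp_objective_eq by (simp add: marg)
  qed
  finally have obj: "mot_objective T m n p \<gamma> D M = ereal (lp_objective T m n p \<gamma> D W)" .
  have "M \<in> mot_feasible T m n"
    unfolding mot_feasible_def
  proof (intro CollectI conjI ballI)
    fix t i assume t: "t \<in> {1..T}" and i: "i \<in> {1..m+1}"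
    have "(\<Sum>j=1..n+1. marginal T m n t M (i, j)) = (\<Sum>j=1..n+1. W t (i, j))"
      using t i by (intro sum.cong marg) auto
    then show "(\<Sum>j=1..n+1. marginal T m n t M (i, j)) = mu_bar m n i"
      using W(2)[OF t i] by simp
  next
    fix t j assume t: "t \<in> {1..T}" and j: "j \<in> {1..n+1}"
    have "(\<Sum>i=1..m+1. marginal T m n t M (i, j)) = (\<Sum>i=1..m+1. W t (i, j))"
      using t j by (intro sum.cong marg) auto
    then show "(\<Sum>i=1..m+1. marginal T m n t M (i, j)) = mu_tilde m n j"
      using W(3)[OF t j] by simp
  qed (rule M0)
  then show ?thesis using obj by (rule that)
qed

section \<open>Existence of a minimiser\<close>

text \<open>The entry in the corner \<open>(m+1, n+1)\<close>, which the linear programme leaves free, is set to the only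
  value that makes the last row sum \<open>n\<close>. Entries outside the index ranges are set to \<open>0\<close>
  in order to land in a compact set.\<close>

definition balance :: "nat \<Rightarrow> nat \<Rightarrow> nat \<Rightarrow> (nat \<Rightarrow> nat \<times> nat \<Rightarrow> real) \<Rightarrow> nat \<Rightarrow> nat \<times> nat \<Rightarrow> real" where
  "balance T m n W t k =
     (if t \<in> {1..T} \<and> k \<in> cells m n
      then if k = (m+1, n+1) then \<Sum>l\<in>core m n. W t l else W t k else 0)"

text \<open>Summing the constraints on the first \<open>n\<close> columns shows that the last row has mass \<open>n\<close> minus
  the mass of the core, apart from the corner; summing those on the first \<open>m\<close> rows shows the
  analogous fact for the last column. Hence one corner value, the mass of the core,
  balances both, and it is nonnegative.\<close>

lemma balanced_balance:
  assumes "W \<in> lp_feasible T m n"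
  shows "balanced T m n (balance T m n W)"
  unfolding balanced_def
proof (intro ballI conjI)
  fix t assume t: "t \<in> {1..T}"
  let ?B = "balance T m n W t"
  have W0: "\<And>k. k \<in> cells m n \<Longrightarrow> 0 \<le> W t k"
    and col: "\<And>j. j \<in> {1..n} \<Longrightarrow> (\<Sum>i=1..m+1. W t (i, j)) = 1"
    and row: "\<And>i. i \<in> {1..m} \<Longrightarrow> (\<Sum>j=1..n+1. W t (i, j)) = 1"
    using assms t unfolding lp_feasible_def by blast+
  have corner: "(\<Sum>l\<in>core m n. W t l) = (\<Sum>i=1..m. \<Sum>j=1..n. W t (i, j))"
    by (simp add: sum.cartesian_product case_prod_beta)
  have inner: "?B k = W t k" if "k \<in> cells m n" "k \<noteq> (m+1, n+1)" for k
    using that t by (simp add: balance_def)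
  have last: "?B (m+1, n+1) = (\<Sum>l\<in>core m n. W t l)"
    using t by (simp add: balance_def)
  show "0 \<le> ?B k" if "k \<in> cells m n" for k
    using that W0 by (auto simp: balance_def intro!: sum_nonneg)
  show "(\<Sum>j=1..n+1. ?B (i, j)) = mu_bar m n i" if i: "i \<in> {1..m+1}" for i
  proof (cases "i = m+1")
    case True
    have "(\<Sum>j=1..n+1. ?B (i, j)) = (\<Sum>j=1..n. ?B (i, j)) + ?B (m+1, n+1)"
      by (simp add: True)
    also have "(\<Sum>j=1..n. ?B (i, j)) = (\<Sum>j=1..n. W t (m+1, j))"
      using True by (intro sum.cong) (auto simp: inner)
    also have "\<dots> = (\<Sum>j=1..n. 1 - (\<Sum>i=1..m. W t (i, j)))"
      by (rule sum.cong) (use col in \<open>auto simp: algebra_simps\<close>)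
    also have "?B (m+1, n+1) = (\<Sum>j=1..n. \<Sum>i=1..m. W t (i, j))"
      unfolding last corner by (rule sum.swap)
    finally show ?thesis
      using True by (simp add: mu_bar_def sum_subtractf)
  next
    case False
    then have "(\<Sum>j=1..n+1. ?B (i, j)) = (\<Sum>j=1..n+1. W t (i, j))"
      using i by (intro sum.cong refl inner) auto
    with False show ?thesis
      using i row by (simp add: mu_bar_def)
  qed
  show "(\<Sum>i=1..m+1. ?B (i, j)) = mu_tilde m n j" if j: "j \<in> {1..n+1}" for j
  proof (cases "j = n+1")
    case True
    have "(\<Sum>i=1..m+1. ?B (i, j)) = (\<Sum>i=1..m. ?B (i, j)) + ?B (m+1, n+1)"
      by (simp add: True)
    also have "(\<Sum>i=1..m. ?B (i, j)) = (\<Sum>i=1..m. W t (i, n+1))"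
      using True by (intro sum.cong) (auto simp: inner)
    also have "\<dots> = (\<Sum>i=1..m. 1 - (\<Sum>j=1..n. W t (i, j)))"
      by (rule sum.cong) (use row in \<open>auto simp: algebra_simps\<close>)
    finally show ?thesis
      using True unfolding last corner by (simp add: mu_tilde_def sum_subtractf)
  next
    case False
    then have "(\<Sum>i=1..m+1. ?B (i, j)) = (\<Sum>i=1..m+1. W t (i, j))"
      using j by (intro sum.cong refl inner) auto
    with False show ?thesis
      using j col by (simp add: mu_tilde_def)
  qed
qed

lemma lp_objective_balance:
  assumes "\<And>t. t \<in> {1..T} \<Longrightarrow> D t (m+1, n+1) = 0"
  shows "lp_objective T m n p \<gamma> D (balance T m n W) = lp_objective T m n p \<gamma> D W"
proof -
  have "D t k * balance T m n W t k = D t k * W t k" if "t \<in> {1..T}" "k \<in> cells m n" for t k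
    using that assms by (auto simp: balance_def)
  moreover have "balance T m n W t k = W t k" if "t \<in> {1..T}" "k \<in> core m n" for t k
    using that by (auto simp: balance_def)
  ultimately show ?thesis
    unfolding lp_objective_eq by (intro arg_cong2[where f = "(+)"] sum.cong) auto
qed

lemma compact_Collect_all_in:
  fixes S :: "'i \<Rightarrow> 'b::topological_space set"
  assumes "\<And>x. compact (S x)"
  shows "compact {f. \<forall>x. f x \<in> S x}"
proof -
  have "compactin (product_topology (\<lambda>_. euclidean) UNIV) (Pi\<^sub>E UNIV S)"
    using assms by (simp add: compactin_PiE)
  moreover have "Pi\<^sub>E UNIV S = {f. \<forall>x. f x \<in> S x}" by auto
  ultimately show ?thesis by (simp add: euclidean_product_topology)
qed

lemma continuous_on_entry: "continuous_on A (\<lambda>W :: 'i \<Rightarrow> 'k \<Rightarrow> real. W t k)"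
  by (rule continuous_on_product_then_coordinatewise[OF
        continuous_on_product_then_coordinatewise[OF continuous_on_id]])

lemma continuous_on_lp_objective: "continuous_on A (lp_objective T m n p \<gamma> D)"
  unfolding lp_objective_def[abs_def] by (intro continuous_on_add continuous_on_mult continuous_on_sum continuous_on_rabs
      continuous_on_diff continuous_on_const continuous_on_entry)

text \<open>Entries of a balanced matrix are bounded by their row sums, so these families form a closed
  subset of a product of compact intervals.\<close>

lemma compact_balanced:
  "compact {W. balanced T m n W \<and> (\<forall>t k. t \<in> {1..T} \<and> k \<in> cells m n \<or> W t k = 0)}"
    (is "compact ?S")
proof -
  define B where "B t k = (if t \<in> {1..T} \<and> k \<in> cells m n then {0..real n + 1} else {0})" for t k
  let ?box = "{W. \<forall>t. W t \<in> {w. \<forall>k. w k \<in> B t k}}"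
  let ?R = "\<Inter>t\<in>{1..T}. \<Inter>i\<in>{1..m+1}. {W. (\<Sum>j=1..n+1. W t (i, j)) = mu_bar m n i}"
  let ?C = "\<Inter>t\<in>{1..T}. \<Inter>j\<in>{1..n+1}. {W. (\<Sum>i=1..m+1. W t (i, j)) = mu_tilde m n j}"
  have "compact ?box"
    by (intro compact_Collect_all_in) (simp add: B_def)
  moreover have "closed (?R \<inter> ?C)"
    by (intro closed_Int closed_INT ballI closed_Collect_eq continuous_on_sum
        continuous_on_entry continuous_on_const)
  ultimately have "compact (?box \<inter> (?R \<inter> ?C))"
    by (rule compact_Int_closed)
  also have "?box \<inter> (?R \<inter> ?C) = ?S"
  proof (intro set_eqI iffI)
    fix W assume W: "W \<in> ?box \<inter> (?R \<inter> ?C)"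
    then have B: "W t k \<in> B t k" for t k by blast
    have "balanced T m n W"
      unfolding balanced_def
    proof (intro ballI conjI)
      show "0 \<le> W t k" if "t \<in> {1..T}" "k \<in> cells m n" for t k
        using B[of t k] that unfolding B_def by (simp only: if_True simp_thms atLeastAtMost_iff)
    qed (use W in simp_all)
    moreover have "t \<in> {1..T} \<and> k \<in> cells m n \<or> W t k = 0" for t k
      using B[of t k] unfolding B_def by (cases "t \<in> {1..T} \<and> k \<in> cells m n") auto
    ultimately show "W \<in> ?S" by blast
  next
    fix W assume "W \<in> ?S"
    then have bal: "balanced T m n W"
      and zero: "\<And>t k. t \<in> {1..T} \<and> k \<in> cells m n \<or> W t k = 0" by blast+
    have "W t k \<in> B t k" for t k
    proof (cases "t \<in> {1..T} \<and> k \<in> cells m n")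
      case True
      then obtain i j where k: "k = (i, j)" and i: "i \<in> {1..m+1}" and j: "j \<in> {1..n+1}" by blast
      have t: "t \<in> {1..T}" using True by blast
      have W0: "0 \<le> W t (i, j)" if "j \<in> {1..n+1}" for j
        using balancedD(1)[OF bal t, of "(i, j)"] i that by blast
      have "W t (i, j) \<le> (\<Sum>j=1..n+1. W t (i, j))"
        using j W0 by (intro member_le_sum[of j _ "\<lambda>j. W t (i, j)"]) auto
      also have "\<dots> = mu_bar m n i"
        by (rule balancedD(2)[OF bal t i])
      also have "\<dots> \<le> real n + 1" by (simp add: mu_bar_def)
      finally show ?thesis
        using True W0[OF j] by (simp add: B_def k)
    next
      case False
      then have "B t k = {0}" by (simp only: B_def if_False)
      moreover have "W t k = 0" using zero[of t k] False by blast
      ultimately show ?thesis by simp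
    qed
    moreover have "W \<in> ?R" "W \<in> ?C"
      using balancedD(2,3)[OF bal] by blast+
    ultimately show "W \<in> ?box \<inter> (?R \<inter> ?C)" by simp
  qed
  finally show ?thesis .
qed

lemma lp_feasible_nonempty: "lp_feasible T m n \<noteq> {}"
proof -
  \<comment> \<open>All trajectories are left unassigned.\<close>
  have "(\<lambda>t (i, j). of_bool ((i = m+1) \<noteq> (j = n+1))) \<in> lp_feasible T m n"
    by (auto simp: lp_feasible_def)
  then show ?thesis by blast
qed

text \<open>Since the corner is free of charge, balancing does not change the objective, and a minimum over the
  compact set of balanced families is a minimum over all feasible ones.\<close>

lemma exists_balanced_minimizer:
  assumes D: "\<And>t. t \<in> {1..T} \<Longrightarrow> D t (m+1, n+1) = 0"
  obtains W where "balanced T m n W"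
    and "\<And>W'. W' \<in> lp_feasible T m n \<Longrightarrow> lp_objective T m n p \<gamma> D W \<le> lp_objective T m n p \<gamma> D W'"
proof -
  let ?S = "{W. balanced T m n W \<and> (\<forall>t k. t \<in> {1..T} \<and> k \<in> cells m n \<or> W t k = 0)}"
  have bal: "balance T m n W \<in> ?S" if "W \<in> lp_feasible T m n" for W
    using balanced_balance[OF that] by (auto simp: balance_def)
  then have "?S \<noteq> {}" using lp_feasible_nonempty by blast
  from continuous_attains_inf[OF compact_balanced this
      continuous_on_lp_objective[of _ T m n p \<gamma> D]]
  obtain W where W: "W \<in> ?S"
    and min: "\<And>W'. W' \<in> ?S \<Longrightarrow> lp_objective T m n p \<gamma> D W \<le> lp_objective T m n p \<gamma> D W'"
    by blast
  show ?thesis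
  proof (rule that[of W])
    show "balanced T m n W" using W by blast
    show "lp_objective T m n p \<gamma> D W \<le> lp_objective T m n p \<gamma> D W'" if "W' \<in> lp_feasible T m n" for W'
      using min[OF bal[OF that]] lp_objective_balance[of T D m n p \<gamma> W'] D by simp
  qed
qed

section \<open>Equality of the optimal values\<close>

lemma is_optimal_valueI:
  assumes "x \<in> S" "f x = v" "\<And>y. y \<in> S \<Longrightarrow> v \<le> f y"
  shows "is_optimal_value f S v"
  using assms by (auto simp: is_optimal_value_def is_arg_min_linorder)

text \<open>The property of the cost matrices behind the equality is that pairing two empty trajectories is free.
  A balanced minimiser \<open>W\<close> and its tensor \<open>M\<close> have the same cost. The tensor is a minimiser
  because a cheaper one would have cheaper marginals, in contradiction to the minimality of \<open>W\<close>.\<close>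

theorem mot_lp_same_optimal_value:
  assumes "1 \<le> T" and D: "\<And>t. t \<in> {1..T} \<Longrightarrow> D t (m+1, n+1) = 0"
  shows "\<exists>v. is_optimal_value (mot_objective T m n p \<gamma> D) (mot_feasible T m n) v \<and>
             is_optimal_value (\<lambda>W. ereal (lp_objective T m n p \<gamma> D W)) (lp_feasible T m n) v"
proof -
  obtain W where W: "balanced T m n W"
    and min: "\<And>W'. W' \<in> lp_feasible T m n \<Longrightarrow> lp_objective T m n p \<gamma> D W \<le> lp_objective T m n p \<gamma> D W'"
    using exists_balanced_minimizer D by metis
  obtain M where M: "M \<in> mot_feasible T m n"
    "mot_objective T m n p \<gamma> D M = ereal (lp_objective T m n p \<gamma> D W)"
    using exists_transport_plan[OF assms(1) W] .
  have "ereal (lp_objective T m n p \<gamma> D W) \<le> mot_objective T m n p \<gamma> D M'"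
    if "M' \<in> mot_feasible T m n" for M'
    using min[OF lp_feasible_marginal[OF that]] lp_marginal_le_mot[OF that]
    by (meson ereal_less_eq(3) order_trans)
  then show ?thesis
    using is_optimal_valueI[of M "mot_feasible T m n" "mot_objective T m n p \<gamma> D", OF M]
      is_optimal_valueI[of W "lp_feasible T m n" "\<lambda>W. ereal (lp_objective T m n p \<gamma> D W)"]
      balanced_imp_lp_feasible[OF W] min by auto
qed

theorem theorem1:
  fixes T m n :: nat and p c \<gamma> :: real
    and X Y :: "nat \<Rightarrow> (real ^ 'N) trajectory"
    and D :: "nat \<Rightarrow> nat \<times> nat \<Rightarrow> real"
  assumes "T \<ge> 1" and "m \<ge> 1" and "n \<ge> 1"
    and "1 \<le> p" and "\<gamma> > 0" and "c > 0"
    and "D = cost_matrix p c m n X Y"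
  shows "\<exists>v. is_optimal_value (mot_objective T m n p \<gamma> D) (mot_feasible T m n) v \<and>
             is_optimal_value (\<lambda>W. ereal (lp_objective T m n p \<gamma> D W)) (lp_feasible T m n) v"
  using assms(1)
proof (rule mot_lp_same_optimal_value)
  show "D t (m+1, n+1) = 0" for t
    using assms by (simp add: cost_matrix_def state_def)
qed

end
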